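(* Let $f:X\to Y$ be a bornologous function of metric spaces. If $f$ has MSP and $Y$ has MSP, then $X$ has MSP.
   Context: A function $f:X\to Y$ of metric spaces is bornologous if there is a function $E:[0,\infty)\to[0,\infty)$ such that the image of every subset of $X$ of diameter at most $r$ has diameter at most $E(r)$. A family of subsets is $R$-disjoint if $d(x,y)\ge R$ whenever $x$ and $y$ belong to different elements of the family; it is uniformly bounded if the diameters of its members have a common finite upper bound. A metric space $X$ has MSP (Metric Sparsification Property) if for all $R>0$ and for each positive $c<1$ there exists $S>0$ such that for all probability measures $\mu$ on $X$ there exists an $R$-disjoint family $\{\Omega_i\}_{i\ge 1}$ of subsets of $X$ of diameter at most $S$ satisfying $\sum_{i=1}^\infty\mu(\Omega_i)>c$. Here probability measures on $X$ are countably additive and defined on all subsets of $X$. The dimension of a family of subsets is the combinatorial dimension of its nerve, i.e. the supremum of all $k$ such that some $k+1$ members have a common point. A metric space $A$ has $\mathrm{asdim}\,A\le m$ ($m\ge 0$ an integer) if every uniformly bounded cover of $A$ can be coarsened to a uniformly bounded family of dimension at most $m$ (i.e. there is such a family such that each element of the cover is contained in some element of it); $\mathrm{asdim}\,A$ is the least such $m\ge 0$, or $\infty$ if there is none. A bornologous function $f:X\to Y$ of metric spaces has MSP if $f^{-1}(A)$ (with the restricted metric) has MSP for every subset $A$ of $Y$ of asymptotic dimension $0$. *)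

theory Defs
  imports "HOL-Probability.Probability"
begin

text \<open>A metric space is a carrier set with a distance function satisfying \<^locale>\<open>Metric_space\<close>;
  a subset of it is regarded as a metric space with the same distance function.\<close>

text \<open>The diameter takes values in the extended nonnegative reals, so that unbounded sets have
  diameter \<open>\<infinity>\<close> and the empty set has diameter \<open>0\<close>.\<close>

definition mdiam :: "('a \<Rightarrow> 'a \<Rightarrow> real) \<Rightarrow> 'a set \<Rightarrow> ennreal" where
  "mdiam d A = (SUP (x, y) \<in> A \<times> A. ennreal (d x y))"

lemma mdiam_le_iff: "r \<ge> 0 \<Longrightarrow> mdiam d A \<le> ennreal r \<longleftrightarrow> (\<forall>x\<in>A. \<forall>y\<in>A. d x y \<le> r)"
  by (auto simp: mdiam_def SUP_le_iff)

definition bornologous ::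
  "'a set \<Rightarrow> ('a \<Rightarrow> 'a \<Rightarrow> real) \<Rightarrow> 'b set \<Rightarrow> ('b \<Rightarrow> 'b \<Rightarrow> real) \<Rightarrow> ('a \<Rightarrow> 'b) \<Rightarrow> bool" where
  "bornologous X dX Y dY f \<longleftrightarrow> f \<in> X \<rightarrow> Y \<and>
     (\<exists>E \<in> {0..} \<rightarrow> {0..}. \<forall>r\<ge>0. \<forall>A\<subseteq>X.
        mdiam dX A \<le> ennreal r \<longrightarrow> mdiam dY (f ` A) \<le> ennreal (E r))"

text \<open>Distinct members of an indexed family are those with distinct indices. (Otherwise
  a single set of positive measure, repeated infinitely often, would satisfy the condition
  in \<open>has_MSP\<close> below.)\<close>

definition R_disjoint :: "('a \<Rightarrow> 'a \<Rightarrow> real) \<Rightarrow> real \<Rightarrow> ('i \<Rightarrow> 'a set) \<Rightarrow> bool" where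
  "R_disjoint d R \<Omega> \<longleftrightarrow> (\<forall>i j. i \<noteq> j \<longrightarrow> (\<forall>x\<in>\<Omega> i. \<forall>y\<in>\<Omega> j. d x y \<ge> R))"

definition uniformly_bounded :: "('a \<Rightarrow> 'a \<Rightarrow> real) \<Rightarrow> 'a set set \<Rightarrow> bool" where
  "uniformly_bounded d \<U> \<longleftrightarrow> (\<exists>B\<ge>0. \<forall>U\<in>\<U>. mdiam d U \<le> ennreal B)"

definition has_MSP :: "'a set \<Rightarrow> ('a \<Rightarrow> 'a \<Rightarrow> real) \<Rightarrow> bool" where
  "has_MSP X d \<longleftrightarrow>
     (\<forall>R>0. \<forall>c. 0 < c \<and> c < 1 \<longrightarrow>
       (\<exists>S>0. \<forall>\<mu>. prob_space \<mu> \<and> space \<mu> = X \<and> sets \<mu> = Pow X \<longrightarrow>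
         (\<exists>\<Omega> :: nat \<Rightarrow> 'a set.
            (\<forall>i. \<Omega> i \<subseteq> X \<and> mdiam d (\<Omega> i) \<le> ennreal S) \<and> R_disjoint d R \<Omega> \<and>
            (\<Sum>i. emeasure \<mu> (\<Omega> i)) > ennreal c)))"

text \<open>The supremum is taken in \<^typ>\<open>enat\<close>: a family without any nonempty member, whose
  nerve is empty, gets dimension \<open>0\<close>. This does not affect bounds by integers \<open>m \<ge> 0\<close>.\<close>

definition family_dim :: "'a set set \<Rightarrow> enat" where
  "family_dim \<V> = (SUP k \<in> {k. \<exists>\<F>\<subseteq>\<V>. finite \<F> \<and> card \<F> = k + 1 \<and> \<Inter>\<F> \<noteq> {}}. enat k)"

definition asdim_le :: "'a set \<Rightarrow> ('a \<Rightarrow> 'a \<Rightarrow> real) \<Rightarrow> nat \<Rightarrow> bool" where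
  "asdim_le A d m \<longleftrightarrow>
     (\<forall>\<U>. \<U> \<subseteq> Pow A \<and> \<Union>\<U> = A \<and> uniformly_bounded d \<U> \<longrightarrow>
       (\<exists>\<V>. \<V> \<subseteq> Pow A \<and> uniformly_bounded d \<V> \<and> family_dim \<V> \<le> enat m \<and>
            (\<forall>U\<in>\<U>. \<exists>V\<in>\<V>. U \<subseteq> V)))"

text \<open>The infimum of the empty set in \<^typ>\<open>enat\<close> is \<open>\<infinity>\<close>.\<close>

definition asdim :: "'a set \<Rightarrow> ('a \<Rightarrow> 'a \<Rightarrow> real) \<Rightarrow> enat" where
  "asdim A d = (INF m \<in> {m. asdim_le A d m}. enat m)"

definition map_has_MSP ::
  "'a set \<Rightarrow> ('a \<Rightarrow> 'a \<Rightarrow> real) \<Rightarrow> 'b set \<Rightarrow> ('b \<Rightarrow> 'b \<Rightarrow> real) \<Rightarrow> ('a \<Rightarrow> 'b) \<Rightarrow> bool" where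
  "map_has_MSP X dX Y dY f \<longleftrightarrow> (\<forall>A\<subseteq>Y. asdim A dY = 0 \<longrightarrow> has_MSP (f -` A \<inter> X) dX)"

end

theory Submission
  imports Defs
begin

text \<open>Preimages of subsets of \<open>Y\<close> of diameter at most \<open>T\<close> satisfy the sparsification condition
  uniformly. Otherwise there are bad sets \<open>B n\<close> that only admit sparsifications at scales beyond
  \<open>n\<close>. Either infinitely many of them lie in a bounded set, or a subsequence of them becomes
  more and more separated; in both cases the union of those sets has asymptotic dimension \<open>0\<close>,
  so its preimage has MSP, a contradiction. Given a probability measure on \<open>X\<close>, one sparsifies
  its image in \<open>Y\<close> and then, with the uniform constant, the conditional measures on the preimages
  of the pieces. Each step retains a proportion \<open>sqrt c\<close> of the mass.\<close>

section \<open>Sparsification at an explicit scale \<open>S\<close>\<close>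

definition MSP_with :: "'a set \<Rightarrow> ('a \<Rightarrow> 'a \<Rightarrow> real) \<Rightarrow> real \<Rightarrow> real \<Rightarrow> real \<Rightarrow> bool" where
  "MSP_with X d R c S \<longleftrightarrow>
     (\<forall>\<mu>. prob_space \<mu> \<and> space \<mu> = X \<and> sets \<mu> = Pow X \<longrightarrow>
       (\<exists>\<Omega> :: nat \<Rightarrow> 'a set.
          (\<forall>i. \<Omega> i \<subseteq> X \<and> mdiam d (\<Omega> i) \<le> ennreal S) \<and> R_disjoint d R \<Omega> \<and>
          (\<Sum>i. emeasure \<mu> (\<Omega> i)) > ennreal c))"

lemma has_MSP_iff: "has_MSP X d \<longleftrightarrow> (\<forall>R>0. \<forall>c. 0 < c \<and> c < 1 \<longrightarrow> (\<exists>S>0. MSP_with X d R c S))"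
  unfolding has_MSP_def MSP_with_def ..

lemma MSP_with_empty: "MSP_with {} d R c S"
  unfolding MSP_with_def using prob_space.not_empty by blast

lemma mdiam_mono: "A \<subseteq> B \<Longrightarrow> mdiam d A \<le> mdiam d B"
  unfolding mdiam_def by (intro SUP_subset_mono) auto

lemma mdiam_empty [simp]: "mdiam d {} = 0"
  by (simp add: mdiam_def bot_ennreal)

text \<open>A measure on \<open>X'\<close> is pushed forward to \<open>X\<close> along the inclusion
  and sparsified there. Cutting the pieces down to \<open>X'\<close> loses no mass, enlarges no
  diameter and keeps the separation.\<close>

lemma MSP_with_mono:
  assumes "MSP_with X d R c S" and "X' \<subseteq> X" and "S \<le> S'"
  shows "MSP_with X' d R c S'"
  unfolding MSP_with_def
proof (intro allI impI, elim conjE)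
  fix \<mu> assume \<mu>: "prob_space \<mu>" "space \<mu> = X'" "sets \<mu> = Pow X'"
  let ?\<nu> = "distr \<mu> (count_space X) (\<lambda>x. x)"
  have meas: "(\<lambda>x. x) \<in> measurable \<mu> (count_space X)"
    using \<mu> assms(2) by (auto simp: measurable_def)
  have "prob_space ?\<nu>" using \<mu>(1) meas by (rule prob_space.prob_space_distr)
  then obtain \<Omega> :: "nat \<Rightarrow> 'a set" where \<Omega>: "\<And>i. \<Omega> i \<subseteq> X" "\<And>i. mdiam d (\<Omega> i) \<le> ennreal S"
      "R_disjoint d R \<Omega>" "(\<Sum>i. emeasure ?\<nu> (\<Omega> i)) > ennreal c"
    using assms(1) unfolding MSP_with_def by (metis sets_distr sets_count_space space_distr space_count_space)
  have "emeasure ?\<nu> (\<Omega> i) = emeasure \<mu> (\<Omega> i \<inter> X')" for i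
    using emeasure_distr[OF meas, of "\<Omega> i"] \<Omega>(1)[of i] \<mu>(2) by simp
  moreover have "mdiam d (\<Omega> i \<inter> X') \<le> ennreal S'" for i
    using mdiam_mono[of "\<Omega> i \<inter> X'" "\<Omega> i" d] \<Omega>(2)[of i] ennreal_leI[OF assms(3)] by auto
  moreover have "R_disjoint d R (\<lambda>i. \<Omega> i \<inter> X')"
    using \<Omega>(3) by (auto simp: R_disjoint_def)
  ultimately show "\<exists>\<Omega> :: nat \<Rightarrow> 'a set. (\<forall>i. \<Omega> i \<subseteq> X' \<and> mdiam d (\<Omega> i) \<le> ennreal S') \<and>
      R_disjoint d R \<Omega> \<and> ennreal c < (\<Sum>i. emeasure \<mu> (\<Omega> i))"
    using \<Omega>(4) by (intro exI[of _ "\<lambda>i. \<Omega> i \<inter> X'"]) auto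
qed

text \<open>Apply the hypothesis to \<open>\<mu>\<close> conditioned on \<open>P\<close>, then
  multiply by the mass of \<open>P\<close>. The inequality is non-strict so that null sets
  \<open>P\<close>, where conditioning is impossible, are covered by empty pieces.\<close>

lemma MSP_with_subset_measure:
  assumes "MSP_with P d R c S" and "finite_measure \<mu>"
    and "sets \<mu> = Pow X" and "P \<subseteq> X"
  obtains \<Omega> :: "nat \<Rightarrow> 'a set" where "\<And>i. \<Omega> i \<subseteq> P" "\<And>i. mdiam d (\<Omega> i) \<le> ennreal S"
    "R_disjoint d R \<Omega>" "ennreal c * emeasure \<mu> P \<le> (\<Sum>i. emeasure \<mu> (\<Omega> i))"
proof (cases "emeasure \<mu> P = 0")
  case True
  then show ?thesis by (intro that[of "\<lambda>_. {}"]) (auto simp: R_disjoint_def)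
next
  case False
  interpret finite_measure \<mu> by fact
  let ?U = "uniform_measure \<mu> P"
  let ?\<nu> = "restrict_space ?U P"
  have P: "P \<in> sets \<mu>" using assms by auto
  \<comment> \<open>Finiteness of \<open>\<mu>\<close> matters here: an \<open>ennreal\<close>
    divided by itself is 1 only away from 0 and \<infinity>.\<close>
  have self: "emeasure \<mu> P / emeasure \<mu> P = 1"
    using False emeasure_finite[of P] by (intro ennreal_divide_self) (simp_all add: less_top[symmetric])
  then have "emeasure ?U P = 1"
    using P by (simp add: emeasure_uniform_measure)
  then have "prob_space ?\<nu>"
    using P by (intro prob_space_restrict_space) auto
  moreover have "sets ?\<nu> = Pow P"
    using assms(3,4) P by (auto simp: sets_restrict_space_iff)
  moreover have "space ?\<nu> = P"
    using P by (simp add: space_restrict_space2)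
  ultimately obtain \<Omega> :: "nat \<Rightarrow> 'a set" where \<Omega>: "\<And>i. \<Omega> i \<subseteq> P" "\<And>i. mdiam d (\<Omega> i) \<le> ennreal S"
      "R_disjoint d R \<Omega>" "(\<Sum>i. emeasure ?\<nu> (\<Omega> i)) > ennreal c"
    using assms(1) unfolding MSP_with_def by metis
  have "emeasure ?\<nu> (\<Omega> i) = emeasure \<mu> (\<Omega> i) / emeasure \<mu> P" for i
  proof -
    have "emeasure ?\<nu> (\<Omega> i) = emeasure ?U (\<Omega> i)"
      using P \<Omega>(1)[of i] by (intro emeasure_restrict_space) (auto intro: sets.Int_space_eq2)
    also have "\<dots> = emeasure \<mu> (P \<inter> \<Omega> i) / emeasure \<mu> P"
      using P \<Omega>(1)[of i] assms(3,4) by (intro emeasure_uniform_measure) auto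
    finally show ?thesis using \<Omega>(1)[of i] by (simp add: Int_absorb1)
  qed
  then have "ennreal c \<le> (\<Sum>i. emeasure \<mu> (\<Omega> i)) / emeasure \<mu> P"
    using \<Omega>(4) by (simp add: divide_ennreal_def ennreal_suminf_multc)
  then have "ennreal c * emeasure \<mu> P \<le> (\<Sum>i. emeasure \<mu> (\<Omega> i)) / emeasure \<mu> P * emeasure \<mu> P"
    by (rule mult_right_mono) simp
  also have "\<dots> = (\<Sum>i. emeasure \<mu> (\<Omega> i))"
    by (simp only: ennreal_divide_times self mult_1_right)
  finally show ?thesis by (rule that[OF \<Omega>(1-3)])
qed

section \<open>Sets of asymptotic dimension 0\<close>

lemma family_dim_disjoint:
  assumes "pairwise disjnt \<V>"
  shows "family_dim \<V> \<le> 0"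
  unfolding family_dim_def
proof (rule SUP_least, clarify)
  fix k \<F> x assume \<F>: "\<F> \<subseteq> \<V>" "finite \<F>" "card \<F> = k + 1" "\<Inter>\<F> \<noteq> {}"
  then obtain z where "\<And>V. V \<in> \<F> \<Longrightarrow> z \<in> V" by auto
  then have "V = W" if "V \<in> \<F>" "W \<in> \<F>" for V W
    using that \<F>(1) assms unfolding pairwise_def disjnt_def by blast
  then have "card \<F> \<le> Suc 0" using card_le_Suc0_iff_eq[OF \<F>(2)] by blast
  with \<F>(3) show "enat k \<le> 0" by (simp add: zero_enat_def)
qed

text \<open>For a cover by sets of diameter at most \<open>D\<close>, merge all \<open>C k\<close>
  with \<open>k \<le> K\<close> into one bounded set, where \<open>K \<ge> D\<close>. Each later
  \<open>C k\<close> is more than \<open>D\<close> away from all other pieces, so a member of the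
  cover meeting it lies inside it; the remaining members lie in the merged set.\<close>

lemma asdim_UN_diverging:
  fixes C :: "nat \<Rightarrow> 'b set"
  assumes "Metric_space Y d" and CY: "\<And>k. C k \<subseteq> Y"
    and "T \<ge> 0" and diam: "\<And>k. mdiam d (C k) \<le> ennreal T"
    and sep: "\<And>j k x y. \<lbrakk>j < k; x \<in> C j; y \<in> C k\<rbrakk> \<Longrightarrow> d x y > real k"
  shows "asdim (\<Union>k. C k) d = 0"
proof -
  interpret Metric_space Y d by fact
  \<comment> \<open>If \<open>j > k\<close>, then \<open>sep\<close> even gives a distance above
    \<open>j\<close>; hence either index may serve as the bound.\<close>
  have sep': "d x y > real k" if "j \<noteq> k" "x \<in> C j" "y \<in> C k" for j k x y
    using that sep[of j k x y] sep[of k j y x] commute[of x y] by (cases "j < k") auto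
  have disj: "j = k" if "x \<in> C j" "x \<in> C k" for j k x
    using sep'[of j k x x] that CY[of k] mdist_zero[of x] by (cases "j = k") auto
  have "asdim_le (\<Union>k. C k) d 0"
    unfolding asdim_le_def
  proof (intro allI impI, elim conjE)
    fix \<U> assume \<U>: "\<U> \<subseteq> Pow (\<Union>k. C k)" "\<Union>\<U> = (\<Union>k. C k)" "uniformly_bounded d \<U>"
    then obtain D where D: "D \<ge> 0" "\<And>U. U \<in> \<U> \<Longrightarrow> mdiam d U \<le> ennreal D"
      unfolding uniformly_bounded_def by blast
    obtain K :: nat where K: "D \<le> real K" using real_arch_simple by blast
    let ?C0 = "\<Union>k\<le>K. C k"
    let ?V = "insert ?C0 (C ` {K<..})"
    have "mbounded (C k)" for k
      using diam[of k] CY[of k] \<open>T \<ge> 0\<close> by (auto simp: mbounded_alt mdiam_le_iff)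
    then have "mbounded ?C0" by (intro mbounded_Union) auto
    then obtain B where B: "\<And>x y. x \<in> ?C0 \<Longrightarrow> y \<in> ?C0 \<Longrightarrow> d x y \<le> B"
      unfolding mbounded_alt by meson
    have "uniformly_bounded d ?V"
      unfolding uniformly_bounded_def
    \<comment> \<open>\<open>B\<close> bounds the merged set and \<open>T\<close> the other members.
      If the merged set is empty, \<open>B\<close> may be negative; \<open>T\<close> keeps the
      maximum nonnegative.\<close>
    proof (intro exI[of _ "max B T"] conjI ballI)
      fix V assume "V \<in> ?V"
      moreover have "mdiam d ?C0 \<le> ennreal (max B T)"
        using B \<open>T \<ge> 0\<close> by (subst mdiam_le_iff) (auto simp: le_max_iff_disj)
      moreover have "mdiam d (C k) \<le> ennreal (max B T)" for k
        using diam[of k] by (rule order_trans) (simp add: ennreal_leI)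
      ultimately show "mdiam d V \<le> ennreal (max B T)" by blast
    qed (use \<open>T \<ge> 0\<close> in auto)
    moreover have "pairwise disjnt ?V"
      unfolding pairwise_def disjnt_def by (auto dest: disj)
    then have "family_dim ?V \<le> enat 0" using family_dim_disjoint by (simp add: zero_enat_def)
    moreover have "\<exists>V\<in>?V. U \<subseteq> V" if "U \<in> \<U>" for U
    proof (cases "\<exists>k>K. U \<inter> C k \<noteq> {}")
      case True
      then obtain k y where k: "k > K" "y \<in> U" "y \<in> C k" by auto
      have "U \<subseteq> C k"
      proof
        fix x assume x: "x \<in> U"
        with \<U>(1) that obtain j where j: "x \<in> C j" by blast
        have "d x y \<le> D" using D(2)[OF that] D(1) x k(2) by (auto simp: mdiam_le_iff)
        then have "\<not> d x y > real k" using K k(1) by linarith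
        with sep' j k(3) have "j = k" by blast
        with j show "x \<in> C k" by simp
      qed
      then show ?thesis using k(1) by auto
    next
      case False
      have "U \<subseteq> ?C0"
      proof
        fix x assume x: "x \<in> U"
        with \<U>(1) that obtain j where j: "x \<in> C j" by blast
        with False x have "j \<le> K" by (meson disjoint_iff not_le)
        with j show "x \<in> ?C0" by auto
      qed
      then show ?thesis by auto
    qed
    ultimately show "\<exists>\<V>. \<V> \<subseteq> Pow (\<Union>k. C k) \<and> uniformly_bounded d \<V> \<and>
        family_dim \<V> \<le> enat 0 \<and> (\<forall>U\<in>\<U>. \<exists>V\<in>\<V>. U \<subseteq> V)"
      by (intro exI[of _ ?V]) auto
  qed
  then have "asdim (\<Union>k. C k) d \<le> enat 0"
    unfolding asdim_def by (intro INF_lower) simp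
  then show ?thesis by (simp add: zero_enat_def[symmetric])
qed

text \<open>Followed by empty sets, \<open>A\<close> forms a sequence whose separation condition is
  vacuous.\<close>

lemma asdim_bounded:
  assumes "Metric_space Y d" "A \<subseteq> Y" "T \<ge> 0" "mdiam d A \<le> ennreal T"
  shows "asdim A d = 0"
proof -
  let ?C = "\<lambda>k::nat. if k = 0 then A else {}"
  have "asdim (\<Union>k. ?C k) d = 0"
    using assms by (intro asdim_UN_diverging[of Y d _ T]) auto
  moreover have "(\<Union>k. ?C k) = A" by (auto split: if_splits)
  ultimately show ?thesis by simp
qed

section \<open>One scale for the preimages of all sets of diameter at most \<open>T\<close>\<close>

lemma MSP_with_preimage_uniform:
  assumes Y: "Metric_space Y dY" and f: "map_has_MSP X dX Y dY f"
    and R: "R > 0" and c: "0 < c" "c < 1" and T: "T \<ge> 0"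
  obtains S where "S > 0"
    "\<And>B. B \<subseteq> Y \<Longrightarrow> mdiam dY B \<le> ennreal T \<Longrightarrow> MSP_with (f -` B \<inter> X) dX R c S"
proof (rule ccontr)
  interpret Y: Metric_space Y dY by fact
  assume "\<not> thesis"
  \<comment> \<open>\<open>Suc n\<close> rather than \<open>n\<close>, since a scale has to be
    positive.\<close>
  then have "\<exists>B\<subseteq>Y. mdiam dY B \<le> ennreal T \<and> \<not> MSP_with (f -` B \<inter> X) dX R c (real (Suc n))"
    for n using that[of "real (Suc n)"] by auto
  then obtain B where B: "\<And>n. B n \<subseteq> Y" "\<And>n. mdiam dY (B n) \<le> ennreal T"
      "\<And>n. \<not> MSP_with (f -` B n \<inter> X) dX R c (real (Suc n))"
    by metis
  \<comment> \<open>If \<open>A\<close> contains bad sets of arbitrarily late index, the single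
    scale \<open>S\<close> for the preimage of \<open>A\<close> also works for those with
    \<open>n \<ge> S\<close>, by monotonicity in both set and scale.\<close>
  have no_asdim_0: False
    if A: "A \<subseteq> Y" "asdim A dY = 0" and inf: "\<And>m. \<exists>n\<ge>m. B n \<subseteq> A" for A
  proof -
    from f A have "has_MSP (f -` A \<inter> X) dX" unfolding map_has_MSP_def by blast
    with R c obtain S where S: "MSP_with (f -` A \<inter> X) dX R c S" unfolding has_MSP_iff by blast
    obtain m :: nat where "S \<le> real m" using real_arch_simple by blast
    moreover obtain n where "n \<ge> m" "B n \<subseteq> A" using inf by blast
    ultimately have "MSP_with (f -` B n \<inter> X) dX R c (real (Suc n))"
      by (intro MSP_with_mono[OF S]) auto
    with B(3) show False by blast
  qed
  \<comment> \<open>The empty set carries no probability measure, so it is never bad; each bad set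
    thus has a base point.\<close>
  have "B n \<noteq> {}" for n using B(3)[of n] MSP_with_empty by fastforce
  then obtain b where b: "\<And>n. b n \<in> B n" by (meson all_not_in_conv)
  then have bY: "b n \<in> Y" for n using B(1) by blast
  have dB: "dY x y \<le> T" if "x \<in> B n" "y \<in> B n" for x y n
    using B(2)[of n] T that by (simp add: mdiam_le_iff)
  define \<rho> where "\<rho> n = dY (b 0) (b n)" for n
  show False
  \<comment> \<open>Either the base points return to some fixed ball infinitely often, or their
    distance from \<open>b 0\<close> tends to infinity.\<close>
  proof (cases "\<exists>r. \<forall>m. \<exists>n\<ge>m. \<rho> n \<le> r")
    case True
    then obtain r where r: "\<And>m. \<exists>n\<ge>m. \<rho> n \<le> r" by blast
    let ?A = "Y.mcball (b 0) (r + T)"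
    have "r \<ge> 0" using r[of 0] Y.nonneg unfolding \<rho>_def by (meson order_trans)
    have "dY x y \<le> 2 * (r + T)" if "x \<in> ?A" "y \<in> ?A" for x y
      using that Y.triangle[of x "b 0" y] by (auto simp: Y.commute)
    then have "mdiam dY ?A \<le> ennreal (2 * (r + T))"
      using \<open>r \<ge> 0\<close> T by (subst mdiam_le_iff) auto
    then have "asdim ?A dY = 0"
      using \<open>r \<ge> 0\<close> T by (intro asdim_bounded[OF Y, of _ "2 * (r + T)"]) auto
    moreover have "B n \<subseteq> ?A" if "\<rho> n \<le> r" for n
    proof
      fix x assume x: "x \<in> B n"
      with B(1) have "x \<in> Y" by blast
      then have "dY (b 0) x \<le> \<rho> n + dY (b n) x" unfolding \<rho>_def using bY by (intro Y.triangle)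
      with dB[OF b x] that \<open>x \<in> Y\<close> bY show "x \<in> ?A" by simp
    qed
    then have "\<exists>n\<ge>m. B n \<subseteq> ?A" for m using r[of m] by blast
    ultimately show False using no_asdim_0[of ?A] Y.mcball_subset_mspace by blast
  next
    case False
    have far: "\<exists>n\<ge>m. \<rho> n > r" for m r
    proof -
      from False obtain m' where "\<And>n. n \<ge> m' \<Longrightarrow> \<rho> n > r" by (meson not_le)
      then show ?thesis by (intro exI[of _ "max m m'"]) simp
    qed
    \<comment> \<open>The term \<open>2 * T\<close> pays for moving from the two base points to
      arbitrary points of their sets; \<open>Suc k\<close> is the separation required at the new
      index.\<close>
    have "\<exists>s::nat \<Rightarrow> nat. \<forall>k. True \<and>
        (s (Suc k) > s k \<and> \<rho> (s (Suc k)) > \<rho> (s k) + real (Suc k) + 2 * T)"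
    proof (rule dependent_nat_choice)
      fix x k :: nat
      show "\<exists>y. True \<and> (y > x \<and> \<rho> y > \<rho> x + real (Suc k) + 2 * T)"
        using far[of "Suc x" "\<rho> x + real (Suc k) + 2 * T"] by (auto simp: Suc_le_eq)
    qed auto
    then obtain s :: "nat \<Rightarrow> nat" where s: "\<And>k. s (Suc k) > s k"
        "\<And>k. \<rho> (s (Suc k)) > \<rho> (s k) + real (Suc k) + 2 * T" by blast
    \<comment> \<open>Monotonicity extends the gap between consecutive indices to all pairs
      \<open>j < k\<close>.\<close>
    have "mono (\<lambda>k. \<rho> (s k))"
    proof (rule incseq_SucI)
      show "\<rho> (s k) \<le> \<rho> (s (Suc k))" for k using s(2)[of k] T by linarith
    qed
    have "dY x y > real k" if jk: "j < k" "x \<in> B (s j)" "y \<in> B (s k)" for j k x y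
    proof -
      obtain k' where k': "k = Suc k'" "j \<le> k'" using jk(1) by (cases k) auto
      have xy: "x \<in> Y" "y \<in> Y" using that B(1) by blast+
      have "\<rho> (s j) \<le> \<rho> (s k')" using \<open>mono _\<close> k'(2) by (rule monoD)
      then have "\<rho> (s k) - \<rho> (s j) > real k + 2 * T" using s(2)[of k'] k'(1) by simp
      \<comment> \<open>The triangle inequality is used along the path \<open>b 0\<close>,
        \<open>b (s j)\<close>, \<open>x\<close>, \<open>y\<close>, \<open>b (s k)\<close>, whose
        second and last legs...\<close>
      moreover have "\<rho> (s k) \<le> \<rho> (s j) + dY (b (s j)) (b (s k))"
        unfolding \<rho>_def using bY by (intro Y.triangle)
      moreover have "dY (b (s j)) (b (s k)) \<le> dY (b (s j)) x + dY x (b (s k))"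
        using bY xy by (intro Y.triangle)
      moreover have "dY x (b (s k)) \<le> dY x y + dY y (b (s k))"
        using bY xy by (intro Y.triangle)
      moreover have "dY (b (s j)) x \<le> T" "dY y (b (s k)) \<le> T"
        using dB b that by blast+
      ultimately show ?thesis by linarith
    qed
    then have "asdim (\<Union>k. B (s k)) dY = 0"
      using B T by (intro asdim_UN_diverging[OF Y, of _ T]) auto
    \<comment> \<open>Strict growth gives \<open>s m \<ge> m\<close>, so the union contains bad sets
      of arbitrarily late index.\<close>
    moreover have "\<exists>n\<ge>m. B n \<subseteq> (\<Union>k. B (s k))" for m
      using strict_mono_imp_increasing[of s m] s(1) by (auto simp: strict_mono_Suc_iff)
    ultimately show False using B(1) by (intro no_asdim_0[of "\<Union>k. B (s k)"]) auto
  qed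
qed

section \<open>Gluing sparsifications over the pieces in \<open>Y\<close>\<close>

theorem theorem7p9:
  fixes X :: "'a set" and dX :: "'a \<Rightarrow> 'a \<Rightarrow> real"
    and Y :: "'b set" and dY :: "'b \<Rightarrow> 'b \<Rightarrow> real"
    and f :: "'a \<Rightarrow> 'b"
  assumes "Metric_space X dX" and "Metric_space Y dY"
    and "bornologous X dX Y dY f"
    and "map_has_MSP X dX Y dY f"
    and "has_MSP Y dY"
  shows "has_MSP X dX"
  unfolding has_MSP_iff
proof (intro allI impI, elim conjE)
  fix R c :: real assume R: "R > 0" and c: "0 < c" "c < 1"
  interpret X: Metric_space X dX by fact
  have fXY: "f \<in> X \<rightarrow> Y" using assms(3) unfolding bornologous_def by blast
  obtain E where E: "E \<in> {0..} \<rightarrow> {0..}" "\<And>r A. r \<ge> 0 \<Longrightarrow> A \<subseteq> X \<Longrightarrow> mdiam dX A \<le> ennreal r \<Longrightarrow>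
      mdiam dY (f ` A) \<le> ennreal (E r)"
    using assms(3) unfolding bornologous_def by (elim conjE bexE) simp
  have ER: "E R \<ge> 0" using E(1) R by auto
  \<comment> \<open>Bornologousness is applied to a two-point set.\<close>
  have f_close: "dY (f x) (f y) \<le> E R" if "x \<in> X" "y \<in> X" "dX x y < R" for x y
  proof -
    have "mdiam dX {x, y} \<le> ennreal R"
      using that R by (simp add: mdiam_le_iff X.commute)
    then have "mdiam dY (f ` {x, y}) \<le> ennreal (E R)" using that R by (intro E(2)) auto
    then show ?thesis using ER by (simp add: mdiam_le_iff)
  qed
  have c': "0 < sqrt c" "sqrt c < 1" using c by auto
  \<comment> \<open>The extra 1 makes the separation in \<open>Y\<close> exceed \<open>E R\<close>
    strictly, so that by \<open>f_close\<close> points over different pieces are at least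
    \<open>R\<close> apart.\<close>
  have "E R + 1 > 0" using ER by simp
  then obtain T where T: "T > 0" "MSP_with Y dY (E R + 1) (sqrt c) T"
    using assms(5) c' unfolding has_MSP_iff by blast
  \<comment> \<open>Both \<open>T\<close> and \<open>S\<close> are fixed before any measure on
    \<open>X\<close> is given, as the order of quantifiers in MSP demands.\<close>
  obtain S where S: "S > 0"
      "\<And>B. B \<subseteq> Y \<Longrightarrow> mdiam dY B \<le> ennreal T \<Longrightarrow> MSP_with (f -` B \<inter> X) dX R (sqrt c) S"
    using MSP_with_preimage_uniform[OF assms(2,4) R c', of T] T(1) by auto
  have "MSP_with X dX R c S"
    unfolding MSP_with_def
  proof (intro allI impI, elim conjE)
    fix \<mu> assume \<mu>: "prob_space \<mu>" "space \<mu> = X" "sets \<mu> = Pow X"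
    interpret prob_space \<mu> by fact
    let ?\<nu> = "distr \<mu> (count_space Y) f"
    have meas: "f \<in> measurable \<mu> (count_space Y)" using fXY \<mu> by (auto simp: measurable_def)
    then have "prob_space ?\<nu>" by (rule prob_space_distr)
    then obtain \<Omega> :: "nat \<Rightarrow> 'b set" where \<Omega>: "\<And>i. \<Omega> i \<subseteq> Y" "\<And>i. mdiam dY (\<Omega> i) \<le> ennreal T"
        "R_disjoint dY (E R + 1) \<Omega>" "(\<Sum>i. emeasure ?\<nu> (\<Omega> i)) > ennreal (sqrt c)"
      using T(2) unfolding MSP_with_def
      by (metis sets_distr sets_count_space space_distr space_count_space)
    let ?P = "\<lambda>i. f -` \<Omega> i \<inter> X"
    have \<nu>: "emeasure ?\<nu> (\<Omega> i) = emeasure \<mu> (?P i)" for i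
      using emeasure_distr[OF meas, of "\<Omega> i"] \<Omega>(1)[of i] \<mu>(2) by simp
    have "\<exists>W :: nat \<Rightarrow> 'a set. (\<forall>j. W j \<subseteq> ?P i \<and> mdiam dX (W j) \<le> ennreal S) \<and> R_disjoint dX R W \<and>
        ennreal (sqrt c) * emeasure \<mu> (?P i) \<le> (\<Sum>j. emeasure \<mu> (W j))" for i
      using MSP_with_subset_measure[OF S(2)[OF \<Omega>(1,2)] finite_measure_axioms \<mu>(3), of i]
      by (metis Int_lower2)
    then obtain W :: "nat \<Rightarrow> nat \<Rightarrow> 'a set" where W: "\<And>i j. W i j \<subseteq> ?P i"
        "\<And>i j. mdiam dX (W i j) \<le> ennreal S" "\<And>i. R_disjoint dX R (W i)"
        "\<And>i. ennreal (sqrt c) * emeasure \<mu> (?P i) \<le> (\<Sum>j. emeasure \<mu> (W i j))"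
      by metis
    \<comment> \<open>The doubly indexed pieces are listed as one sequence; since
      \<open>prod_decode\<close> is injective, distinct positions mean distinct index pairs.\<close>
    let ?W = "\<lambda>n. case prod_decode n of (i, j) \<Rightarrow> W i j"
    \<comment> \<open>Pieces over the same \<open>\<Omega> i\<close> are separated by the choice of
      \<open>W i\<close>, pieces over different ones by the separation of their images.\<close>
    have disj: "dX x y \<ge> R" if "(i, j) \<noteq> (k, l)" "x \<in> W i j" "y \<in> W k l" for i j k l x y
    proof (cases "i = k")
      case True
      with that W(3)[of i] show ?thesis unfolding R_disjoint_def by auto
    next
      case False
      have xy: "f x \<in> \<Omega> i" "f y \<in> \<Omega> k" "x \<in> X" "y \<in> X" using that W(1) by blast+
      then have "dY (f x) (f y) \<ge> E R + 1" using \<Omega>(3) False unfolding R_disjoint_def by blast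
      with f_close[OF xy(3,4)] show ?thesis by linarith
    qed
    have "R_disjoint dX R ?W"
      unfolding R_disjoint_def
    proof (intro allI impI ballI)
      fix m n x y assume "m \<noteq> n" and "x \<in> ?W m" "y \<in> ?W n"
      then show "R \<le> dX x y"
        using disj[of "fst (prod_decode m)" "snd (prod_decode m)"
            "fst (prod_decode n)" "snd (prod_decode n)" x y]
        by (auto simp: case_prod_unfold prod_decode_eq)
    qed
    moreover have "?W n \<subseteq> X \<and> mdiam dX (?W n) \<le> ennreal S" for n
      using W(1,2) by (cases "prod_decode n") auto
    moreover have "ennreal c < (\<Sum>n. emeasure \<mu> (?W n))"
    proof -
      \<comment> \<open>Strictness comes from the sparsification of \<open>Y\<close> alone, as the
        bounds \<open>W(4)\<close> on the fibres are non-strict.\<close>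
      have "ennreal c = ennreal (sqrt c) * ennreal (sqrt c)"
        using c by (simp flip: ennreal_mult)
      also have "\<dots> < ennreal (sqrt c) * (\<Sum>i. emeasure \<mu> (?P i))"
        using \<Omega>(4) c' unfolding \<nu> by (intro ennreal_mult_strict_left_mono) auto
      also have "\<dots> = (\<Sum>i. ennreal (sqrt c) * emeasure \<mu> (?P i))" by simp
      also have "\<dots> \<le> (\<Sum>i. \<Sum>j. emeasure \<mu> (W i j))" using W(4) by (intro suminf_le) auto
      \<comment> \<open>A double series of nonnegative terms may be summed along the enumeration of
        pairs.\<close>
      also have "\<dots> = (\<Sum>n. emeasure \<mu> (?W n))"
        using suminf_ennreal_2dimen[of "\<lambda>i. \<Sum>j. emeasure \<mu> (W i j)" "\<lambda>(i, j). emeasure \<mu> (W i j)"]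
        by (simp add: case_prod_unfold comp_def)
      finally show ?thesis .
    qed
    ultimately show "\<exists>\<Omega> :: nat \<Rightarrow> 'a set. (\<forall>i. \<Omega> i \<subseteq> X \<and> mdiam dX (\<Omega> i) \<le> ennreal S) \<and>
        R_disjoint dX R \<Omega> \<and> ennreal c < (\<Sum>i. emeasure \<mu> (\<Omega> i))"
      by (intro exI[of _ ?W]) auto
  qed
  with S(1) show "\<exists>S>0. MSP_with X dX R c S" by blast
qed

end
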